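(* For every integer $n\geq 3$ there exists a semisymmetric quasigroup of order $n$ with an empty nucleus.
   Context: A semisymmetric quasigroup is a set $Q$ with a binary operation $\cdot$ satisfying $(x\cdot y)\cdot x = y$ for all $x,y\in Q$; its order is $|Q|$. Juxtaposition denotes the operation with higher precedence. The nucleus is $N(Q)=N_\lambda(Q)\cap N_\mu(Q)\cap N_\rho(Q)$, where $N_\lambda(Q)=\{u\in Q: u\cdot xy = ux\cdot y \text{ for all } x,y\in Q\}$, $N_\mu(Q)=\{u\in Q: x\cdot uy = xu\cdot y \text{ for all } x,y\in Q\}$, $N_\rho(Q)=\{u\in Q: x\cdot yu = xy\cdot u \text{ for all } x,y\in Q\}$. *)

theory Defs
  imports Main
begin

locale semisymmetric_quasigroup =
  fixes Q :: "'a set" and mult :: "'a \<Rightarrow> 'a \<Rightarrow> 'a" (infixl "\<cdot>" 70)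
  assumes closed: "x \<in> Q \<Longrightarrow> y \<in> Q \<Longrightarrow> x \<cdot> y \<in> Q"
    and semisymmetric: "x \<in> Q \<Longrightarrow> y \<in> Q \<Longrightarrow> (x \<cdot> y) \<cdot> x = y"
begin

lemma semisymmetric': "x \<in> Q \<Longrightarrow> y \<in> Q \<Longrightarrow> x \<cdot> (y \<cdot> x) = y"
  by (metis closed semisymmetric)

text \<open>The semisymmetric law alone makes \<open>Q\<close> a quasigroup, so unique solvability
  of equations need not be assumed separately.\<close>

lemma unique_division:
  assumes "a \<in> Q" "b \<in> Q"
  shows "\<exists>!x. x \<in> Q \<and> a \<cdot> x = b" "\<exists>!y. y \<in> Q \<and> y \<cdot> a = b"
  using assms by (metis closed semisymmetric semisymmetric')+

end

definition left_nucleus :: "'a set \<Rightarrow> ('a \<Rightarrow> 'a \<Rightarrow> 'a) \<Rightarrow> 'a set" where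
  "left_nucleus Q m = {u \<in> Q. \<forall>x\<in>Q. \<forall>y\<in>Q. m u (m x y) = m (m u x) y}"

definition middle_nucleus :: "'a set \<Rightarrow> ('a \<Rightarrow> 'a \<Rightarrow> 'a) \<Rightarrow> 'a set" where
  "middle_nucleus Q m = {u \<in> Q. \<forall>x\<in>Q. \<forall>y\<in>Q. m x (m u y) = m (m x u) y}"

definition right_nucleus :: "'a set \<Rightarrow> ('a \<Rightarrow> 'a \<Rightarrow> 'a) \<Rightarrow> 'a set" where
  "right_nucleus Q m = {u \<in> Q. \<forall>x\<in>Q. \<forall>y\<in>Q. m x (m y u) = m (m x y) u}"

definition nucleus :: "'a set \<Rightarrow> ('a \<Rightarrow> 'a \<Rightarrow> 'a) \<Rightarrow> 'a set" where
  "nucleus Q m = left_nucleus Q m \<inter> middle_nucleus Q m \<inter> right_nucleus Q m"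

end

theory Submission imports Defs begin

text \<open>
  In any abelian group, \<open>x \<cdot> y = -x - y\<close> is semisymmetric, because \<open>z = x \<cdot> y\<close> says
  \<open>x + y + z = 0\<close>, a condition invariant under permuting \<open>x\<close>, \<open>y\<close>, \<open>z\<close>.
  Here \<open>u \<cdot> (x \<cdot> y) = x + y - u\<close> whereas \<open>(u \<cdot> x) \<cdot> y = u + x - y\<close>, so that
  \<open>u\<close> lies in the left nucleus only if \<open>2y = 2u\<close> for every \<open>y\<close>. In the cyclic group of order
  \<open>n \<ge> 3\<close> this fails for a neighbour \<open>y = u \<plusminus> 1\<close>, since \<open>2 \<noteq> 0\<close>.
  Hence already the left nucleus is empty.
\<close>

text \<open>For \<open>x\<close> and \<open>y\<close> below \<open>n\<close> the truncated subtraction is exact, and the value is the residue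
  of \<open>-x - y\<close>.\<close>

definition neg_sum_mod :: "nat \<Rightarrow> nat \<Rightarrow> nat \<Rightarrow> nat" where
  "neg_sum_mod n x y = (2 * n - (x + y)) mod n"

lemma neg_sum_mod_less: "0 < n \<Longrightarrow> neg_sum_mod n x y < n"
  by (simp add: neg_sum_mod_def)

lemma dvd_add_neg_sum_mod:
  assumes "x < n" "y < n"
  shows "n dvd x + y + neg_sum_mod n x y"
proof -
  have "(x + y + neg_sum_mod n x y) mod n = (x + y + (2 * n - (x + y))) mod n"
    by (simp add: neg_sum_mod_def mod_simps)
  also have "x + y + (2 * n - (x + y)) = 2 * n"
    using assms by simp
  finally show ?thesis
    by (simp add: mod_eq_0_iff_dvd)
qed

text \<open>Residues are unique. This replaces calculation with the operation by divisibility
  of a symmetric sum.\<close>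

lemma neg_sum_mod_eqI:
  assumes "x < n" "y < n" "z < n" "n dvd x + y + z"
  shows "neg_sum_mod n x y = z"
proof -
  let ?w = "neg_sum_mod n x y"
  have "int n dvd int (x + y + ?w) - int (x + y + z)"
    using dvd_add_neg_sum_mod[OF assms(1,2)] assms(4) by (intro dvd_diff) (simp_all only: int_dvd_int_iff)
  then have "int n dvd int ?w - int z"
    by simp
  then have "int ?w mod int n = int z mod int n"
    by (simp add: mod_eq_dvd_iff)
  moreover have "?w < n"
    using assms(1) by (simp add: neg_sum_mod_less)
  ultimately show ?thesis
    using assms(3) by simp
qed

lemma semisymmetric_quasigroup_neg_sum_mod:
  "semisymmetric_quasigroup {..<n} (neg_sum_mod n)"
proof
  fix x y assume "x \<in> {..<n}" "y \<in> {..<n}"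
  then have xy: "x < n" "y < n" by simp_all
  then have less: "neg_sum_mod n x y < n"
    by (simp add: neg_sum_mod_less)
  then show "neg_sum_mod n x y \<in> {..<n}" by simp
  have "n dvd neg_sum_mod n x y + x + y"
    using dvd_add_neg_sum_mod[OF xy] by (simp add: ac_simps)
  with less xy show "neg_sum_mod n (neg_sum_mod n x y) x = y"
    by (intro neg_sum_mod_eqI)
qed

lemma left_nucleus_neg_sum_mod_dvd:
  assumes "u \<in> left_nucleus {..<n} (neg_sum_mod n)" "y < n"
  shows "int n dvd 2 * (int u - int y)"
proof -
  \<comment> \<open>The middle argument \<open>x\<close> of the associativity law cancels in the end, so any element
    serves for it.\<close>
  define x :: nat where "x = 0"
  define z where "z = neg_sum_mod n x y"
  define v where "v = neg_sum_mod n u x"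
  define w where "w = neg_sum_mod n u z"
  have less: "u < n" "x < n" "z < n" "v < n"
    using assms by (auto simp: left_nucleus_def x_def z_def v_def neg_sum_mod_less)
  have "w = neg_sum_mod n v y"
    using assms less by (simp add: left_nucleus_def w_def z_def v_def)
  then have "n dvd v + y + w"
    using dvd_add_neg_sum_mod less assms(2) by simp
  moreover have "n dvd x + y + z" "n dvd u + x + v" "n dvd u + z + w"
    using dvd_add_neg_sum_mod[of x n y] dvd_add_neg_sum_mod[of u n x]
      dvd_add_neg_sum_mod[of u n z] less assms(2)
    by (simp_all flip: z_def v_def w_def)
  \<comment> \<open>In this combination of the four sums, \<open>x\<close>, \<open>z\<close>, \<open>v\<close> and \<open>w\<close> all cancel.\<close>
  ultimately have "int n dvd (int (u + x + v) + int (u + z + w)) - (int (x + y + z) + int (v + y + w))"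
    by (intro dvd_diff dvd_add) (simp_all only: int_dvd_int_iff)
  then show ?thesis
    by (simp add: algebra_simps)
qed

lemma left_nucleus_neg_sum_mod_empty:
  assumes "n \<ge> 3"
  shows "left_nucleus {..<n} (neg_sum_mod n) = {}"
proof (rule equals0I)
  fix u assume u: "u \<in> left_nucleus {..<n} (neg_sum_mod n)"
  then have "u < n" by (simp add: left_nucleus_def)
  then obtain y where y: "y < n" "\<bar>int u - int y\<bar> = 1"
  proof (cases u)
    case 0
    then show ?thesis using that[of 1] assms by simp
  next
    case (Suc k)
    then show ?thesis using that[of k] \<open>u < n\<close> by simp
  qed
  have "int n dvd 2 * (int u - int y)"
    using left_nucleus_neg_sum_mod_dvd u y(1) .
  then have "int n dvd \<bar>2 * (int u - int y)\<bar>"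
    by simp
  also have "\<bar>2 * (int u - int y)\<bar> = 2"
    using y(2) by (simp add: abs_mult)
  finally show False
    using assms zdvd_imp_le[of "int n" 2] by simp
qed

theorem theorem3p2:
  fixes n :: nat
  assumes "n \<ge> 3"
  shows "\<exists>(Q :: nat set) (m :: nat \<Rightarrow> nat \<Rightarrow> nat).
    semisymmetric_quasigroup Q m \<and> card Q = n \<and> nucleus Q m = {}"
proof (intro exI conjI)
  show "semisymmetric_quasigroup {..<n} (neg_sum_mod n)"
    by (rule semisymmetric_quasigroup_neg_sum_mod)
  show "card {..<n} = n"
    by simp
  show "nucleus {..<n} (neg_sum_mod n) = {}"
    using left_nucleus_neg_sum_mod_empty[OF assms] by (simp add: nucleus_def)
qed

end
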